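(* Let $m\ge 1$ be an integer and let $h,k:(A,\kappa_1)\to(A',\lambda_1)$ be digitally $(\kappa_1,\lambda_1)$-continuous functions between digital images. Then the digital $m$-homotopic distance is not greater than the digital homotopic distance: $$\mathrm{D}_m(h,k)\le \mathrm{D}_{\kappa_1,\lambda_1}(h,k).$$
   Context: Digital images: a digital image is a pair $(A,\kappa)$ with $A\subseteq\mathbb{Z}^r$ and $\kappa$ an adjacency relation on $A$; the basic ones are $c_p$ ($1\le p\le r$), where distinct $a,a'\in\mathbb{Z}^r$ are $c_p$-adjacent iff there are at most $p$ indices $i$ with $|a_i-a'_i|=1$ and $a_i=a'_i$ for all other $i$. Subsets carry the restricted adjacency. $a\leftrightarrow_\kappa a'$ means adjacent. A map $h:(A,\kappa)\to(A',\lambda)$ is digitally $(\kappa,\lambda)$-continuous if $a\leftrightarrow_\kappa a'$ implies that $h(a)=h(a')$ or $h(a)\leftrightarrow_\lambda h(a')$. On a product of digital images, the adjacency $\mathrm{NP}$ (normal/strong product) declares two distinct points adjacent iff in each coordinate they are equal or adjacent. Homotopy: $[0,z]_{\mathbb{Z}}=\{0,1,\dots,z\}$ carries the adjacency $2=c_1$ of $\mathbb{Z}$. Digitally continuous $h,k:(A,\kappa)\to(A',\lambda)$ are digitally homotopic, $h\simeq_{\kappa,\lambda}k$, if for some $z$ there is a digitally continuous $K:(A\times[0,z]_{\mathbb{Z}},\mathrm{NP}(\kappa,2))\to(A',\lambda)$ with $K(a,0)=h(a)$, $K(a,z)=k(a)$ for all $a$ (in particular $K(\cdot,t)$ and $K(a,\cdot)$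 are digitally continuous for fixed $t$, $a$). For $m>0$, an $m$-dimensional digital complex is a finite digital image $(P,\delta)$ with $P\subseteq\mathbb{Z}^m$. Digital $m$-homotopic distance $\mathrm{D}_m(h,k)=\mathrm{D}_m(h,k;\kappa_1,\lambda_1)$: the least integer $q\ge0$ such that $A=X_0\cup\dots\cup X_q$ where, for each $j$, every $m$-dimensional digital complex $(P,\delta)$ and every $(\delta,\kappa_1)$-continuous $\phi:P\to X_j$ satisfy $h\circ\phi\simeq_{\delta,\lambda_1}k\circ\phi$ ($\infty$ if there is no such $q$). Digital homotopic distance $\mathrm{D}_{\kappa_1,\lambda_1}(h,k)$: the least integer $q\ge 0$ such that $A=X_0\cup\dots\cup X_q$ with $h|_{X_j}\simeq_{\kappa_1,\lambda_1}k|_{X_j}$ for each $j$ ($\infty$ if there is no such $q$). *)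

theory Defs
  imports Main "HOL-Library.FuncSet" "HOL-Library.Extended_Nat"
begin

text \<open>
  Points of $Z^r$ are integer lists of length \<open>r\<close>, so that the dimension is an ordinary
  natural number.  An adjacency is a binary predicate that is only ever consulted on the carrier
  set; a subset therefore carries the restricted adjacency without any change of predicate.
\<close>

definition int_space :: "nat \<Rightarrow> int list set" where
  "int_space r = {x. length x = r}"

definition adjacency_on :: "'a set \<Rightarrow> ('a \<Rightarrow> 'a \<Rightarrow> bool) \<Rightarrow> bool" where
  "adjacency_on A \<kappa> \<longleftrightarrow> irreflp_on A \<kappa> \<and> symp_on A \<kappa>"

definition digital_image :: "nat \<Rightarrow> int list set \<Rightarrow> (int list \<Rightarrow> int list \<Rightarrow> bool) \<Rightarrow> bool" where
  "digital_image r A \<kappa> \<longleftrightarrow> A \<subseteq> int_space r \<and> adjacency_on A \<kappa>"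

text \<open>The adjacency $c_p$: distinct points, every coordinate in which they differ differs by
  exactly 1, and there are at most \<open>p\<close> such coordinates.\<close>

definition c_adj :: "nat \<Rightarrow> int list \<Rightarrow> int list \<Rightarrow> bool" where
  "c_adj p x y \<longleftrightarrow> length x = length y \<and> x \<noteq> y \<and>
     card {i. i < length x \<and> \<bar>x ! i - y ! i\<bar> = 1} \<le> p \<and>
     (\<forall>i < length x. \<bar>x ! i - y ! i\<bar> \<noteq> 1 \<longrightarrow> x ! i = y ! i)"

definition np_adj ::
  "('a \<Rightarrow> 'a \<Rightarrow> bool) \<Rightarrow> ('b \<Rightarrow> 'b \<Rightarrow> bool) \<Rightarrow> 'a \<times> 'b \<Rightarrow> 'a \<times> 'b \<Rightarrow> bool" where
  "np_adj \<kappa> \<nu> u v \<longleftrightarrow> u \<noteq> v \<and>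
     (fst u = fst v \<or> \<kappa> (fst u) (fst v)) \<and> (snd u = snd v \<or> \<nu> (snd u) (snd v))"

definition digitally_continuous ::
  "'a set \<Rightarrow> ('a \<Rightarrow> 'a \<Rightarrow> bool) \<Rightarrow> 'b set \<Rightarrow> ('b \<Rightarrow> 'b \<Rightarrow> bool) \<Rightarrow> ('a \<Rightarrow> 'b) \<Rightarrow> bool" where
  "digitally_continuous A \<kappa> B \<mu> h \<longleftrightarrow> h \<in> A \<rightarrow> B \<and>
     (\<forall>x\<in>A. \<forall>y\<in>A. \<kappa> x y \<longrightarrow> h x = h y \<or> \<mu> (h x) (h y))"

text \<open>The adjacency "2" of the integers, that is $c_1$ on $Z^1$.\<close>

definition adj2 :: "int \<Rightarrow> int \<Rightarrow> bool" where
  "adj2 s t \<longleftrightarrow> c_adj 1 [s] [t]"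

lemma adj2_iff: "adj2 s t \<longleftrightarrow> \<bar>s - t\<bar> = 1"
proof -
  have "card {i. i < Suc 0 \<and> \<bar>[s] ! i - [t] ! i\<bar> = 1} \<le> card {0::nat}"
    by (rule card_mono) auto
  then show ?thesis by (auto simp: adj2_def c_adj_def)
qed

definition digitally_homotopic ::
  "'a set \<Rightarrow> ('a \<Rightarrow> 'a \<Rightarrow> bool) \<Rightarrow> 'b set \<Rightarrow> ('b \<Rightarrow> 'b \<Rightarrow> bool) \<Rightarrow> ('a \<Rightarrow> 'b) \<Rightarrow> ('a \<Rightarrow> 'b) \<Rightarrow> bool"
where
  "digitally_homotopic A \<kappa> B \<mu> h k \<longleftrightarrow>
     digitally_continuous A \<kappa> B \<mu> h \<and> digitally_continuous A \<kappa> B \<mu> k \<and>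
     (\<exists>z\<ge>0. \<exists>K. digitally_continuous (A \<times> {0..z}) (np_adj \<kappa> adj2) B \<mu> K \<and>
        (\<forall>a\<in>A. K (a, 0) = h a \<and> K (a, z) = k a))"

definition digital_complex :: "nat \<Rightarrow> int list set \<Rightarrow> (int list \<Rightarrow> int list \<Rightarrow> bool) \<Rightarrow> bool" where
  "digital_complex m P \<delta> \<longleftrightarrow> 0 < m \<and> digital_image m P \<delta> \<and> finite P"

definition least_or_infinity :: "(nat \<Rightarrow> bool) \<Rightarrow> enat" where
  "least_or_infinity Q = (if \<exists>q. Q q then enat (LEAST q. Q q) else \<infinity>)"

definition m_homotopic_distance ::
  "nat \<Rightarrow> 'a set \<Rightarrow> ('a \<Rightarrow> 'a \<Rightarrow> bool) \<Rightarrow> 'b set \<Rightarrow> ('b \<Rightarrow> 'b \<Rightarrow> bool) \<Rightarrow> ('a \<Rightarrow> 'b) \<Rightarrow> ('a \<Rightarrow> 'b) \<Rightarrow> enat"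
where
  "m_homotopic_distance m A \<kappa> B \<mu> h k = least_or_infinity (\<lambda>q.
     \<exists>X. A = (\<Union>j\<le>q. X j) \<and>
       (\<forall>j\<le>q. \<forall>P \<delta> \<phi>. digital_complex m P \<delta> \<longrightarrow> digitally_continuous P \<delta> (X j) \<kappa> \<phi> \<longrightarrow>
          digitally_homotopic P \<delta> B \<mu> (h \<circ> \<phi>) (k \<circ> \<phi>)))"

definition homotopic_distance ::
  "'a set \<Rightarrow> ('a \<Rightarrow> 'a \<Rightarrow> bool) \<Rightarrow> 'b set \<Rightarrow> ('b \<Rightarrow> 'b \<Rightarrow> bool) \<Rightarrow> ('a \<Rightarrow> 'b) \<Rightarrow> ('a \<Rightarrow> 'b) \<Rightarrow> enat"
where
  "homotopic_distance A \<kappa> B \<mu> h k = least_or_infinity (\<lambda>q.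
     \<exists>X. A = (\<Union>j\<le>q. X j) \<and> (\<forall>j\<le>q. digitally_homotopic (X j) \<kappa> B \<mu> h k))"

end

theory Submission
  imports Defs
begin

text \<open>
  If \<open>K\<close> is a homotopy from \<open>h\<close> to \<open>k\<close> on \<open>X\<close> and \<open>\<phi>\<close> maps \<open>P\<close> continuously into \<open>X\<close>, then
  \<open>(p, t) \<mapsto> K (\<phi> p, t)\<close> is a homotopy from \<open>h \<circ> \<phi>\<close> to \<open>k \<circ> \<phi>\<close>. Hence every cover admissible for the
  homotopic distance is admissible for the \<open>m\<close>-homotopic distance.
\<close>

lemma digitally_continuous_comp:
  assumes "digitally_continuous A \<kappa> B \<mu> f" and "digitally_continuous B \<mu> C \<nu> g"
  shows "digitally_continuous A \<kappa> C \<nu> (g \<circ> f)"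
  using assms unfolding digitally_continuous_def Pi_iff comp_apply by metis

text \<open>Each map keeps its own coordinate equal or adjacent, which is all that
  \<open>np_adj\<close> asks of distinct images; if both coordinates collapse, the images are equal,
  as continuity permits.\<close>

lemma digitally_continuous_map_prod:
  assumes "digitally_continuous A \<kappa> A' \<kappa>' f" and "digitally_continuous B \<mu> B' \<mu>' g"
  shows "digitally_continuous (A \<times> B) (np_adj \<kappa> \<mu>) (A' \<times> B') (np_adj \<kappa>' \<mu>') (map_prod f g)"
  using assms unfolding digitally_continuous_def np_adj_def by fastforce

lemma digitally_continuous_id: "digitally_continuous A \<kappa> A \<kappa> id"
  by (simp add: digitally_continuous_def)

lemma digitally_homotopic_comp:
  assumes hom: "digitally_homotopic X \<kappa> B \<mu> h k"
    and \<phi>: "digitally_continuous P \<delta> X \<kappa> \<phi>"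
  shows "digitally_homotopic P \<delta> B \<mu> (h \<circ> \<phi>) (k \<circ> \<phi>)"
proof -
  obtain z K where z: "z \<ge> 0"
    and K: "digitally_continuous (X \<times> {0..z}) (np_adj \<kappa> adj2) B \<mu> K"
    and ends: "\<forall>a\<in>X. K (a, 0) = h a \<and> K (a, z) = k a"
    using hom unfolding digitally_homotopic_def by blast
  \<comment> \<open>Time is left unchanged, so the same length \<open>z\<close> serves.\<close>
  let ?H = "K \<circ> map_prod \<phi> id"
  have "digitally_continuous (P \<times> {0..z}) (np_adj \<delta> adj2) B \<mu> ?H"
    by (intro digitally_continuous_comp[OF _ K] digitally_continuous_map_prod \<phi>
        digitally_continuous_id)
  moreover have "\<forall>p\<in>P. ?H (p, 0) = (h \<circ> \<phi>) p \<and> ?H (p, z) = (k \<circ> \<phi>) p"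
    using ends \<phi> by (auto simp: digitally_continuous_def)
  \<comment> \<open>Continuity of both composites is also required; \<open>hom\<close> supplies it
    for \<open>h\<close> and \<open>k\<close> on \<open>X\<close>.\<close>
  ultimately show ?thesis
    using hom \<phi> z digitally_continuous_comp unfolding digitally_homotopic_def by blast
qed

text \<open>The least witness of \<open>Q\<close> also satisfies \<open>R\<close>, so it bounds the
  least witness of \<open>R\<close>; without a witness of \<open>Q\<close> the right-hand side is
  \<infinity>.\<close>

lemma least_or_infinity_antimono:
  assumes "\<And>q. Q q \<Longrightarrow> R q"
  shows "least_or_infinity R \<le> least_or_infinity Q"
proof (cases "\<exists>q. Q q")
  case True
  then have "R (LEAST q. Q q)"
    using assms by (blast intro: LeastI_ex)
  then show ?thesis
    using True by (auto simp: least_or_infinity_def intro: Least_le)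
qed (simp add: least_or_infinity_def)

theorem theorem3p2:
  fixes m r r' :: nat
    and A A' :: "int list set"
    and \<kappa>\<^sub>1 \<mu>\<^sub>1 :: "int list \<Rightarrow> int list \<Rightarrow> bool"
    and h k :: "int list \<Rightarrow> int list"
  assumes "m \<ge> 1"
    and "digital_image r A \<kappa>\<^sub>1"
    and "digital_image r' A' \<mu>\<^sub>1"
    and "digitally_continuous A \<kappa>\<^sub>1 A' \<mu>\<^sub>1 h"
    and "digitally_continuous A \<kappa>\<^sub>1 A' \<mu>\<^sub>1 k"
  shows "m_homotopic_distance m A \<kappa>\<^sub>1 A' \<mu>\<^sub>1 h k \<le> homotopic_distance A \<kappa>\<^sub>1 A' \<mu>\<^sub>1 h k"
  unfolding m_homotopic_distance_def homotopic_distance_def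
  by (rule least_or_infinity_antimono) (blast intro: digitally_homotopic_comp)

end
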